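(* Let $f_t(x)$, $t\ge T_0$, $x\in\mathbb{R}$, be a time-varying cost function as in the context, and assume: (A1) for every $t\ge T_0$ a minimizer $x_t^*\in\operatorname{argmin}_{x\in\mathbb{R}} f_t(x)$ exists, and there is a constant $c_0>0$ with $|x_t^*|\le c_0$ for all $t\ge T_0$; (A2) for every $T>T_0$ a minimizer $\tilde x(T)\in\operatorname{argmin}_{x\in\mathbb{R}}\int_{T_0}^T f_t(x)\,dt$ exists, and $|\tilde x(T)|$ is bounded by a constant independent of $T$; (A3) for every $R>0$ there is $M_R>0$ such that $|f_t(x)|\le M_R$ for all $|x|\le R$ and all $t\ge T_0$; (A4) the partial derivative $\nabla_t f_t(x)$ of $f_t(x)$ with respect to $t$ is bounded uniformly in $t\ge T_0$ and $x\in\mathbb{R}$. Let $\sigma>0$, $m<-1$ and $b_0>0$ with $b_0>(\frac{-m}{\sigma})^{\frac{1}{1-m}}$, and let $\alpha_t,\beta_t$ be defined for $t\ge T_0$ by $$e^{\beta_t}=(t+b_0)^m,\qquad e^{\alpha_t}=m(t+b_0)^{-1}+\sigma(t+b_0)^{-m}>0,$$ so that $e^{\alpha_t+\beta_t}-\dot\beta_t e^{\beta_t}=\sigma$. Let $x:[T_0,\infty)\to\mathbb{R}$ be a solution of $$\ddot x+(e^{\alpha_t}-\dot\alpha_t)\dot x+e^{2\alpha_t+\beta_t}\nabla f_t(x)=0 .$$ Then there is a constant $c>0$, independent of $T$, such that for all $T>T_0$, $$\int_{T_0}^T\bigl(f_t(x(t))-f_t(\tilde x(T))\bigr)\,dt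\le\frac{c}{\sigma}.$$
   Context: $T_0\ge 0$ is the initial time. The cost function $(t,x)\mapsto f_t(x)\in\mathbb{R}$, $t\ge T_0$, $x\in\mathbb{R}$, is continuously differentiable, convex in $x$ for every $t$, and smooth in $t$; for every $t$ it has at least one minimizer over $\mathbb{R}$. $\nabla f_t(x)$ denotes the derivative with respect to $x$ and $\nabla_t f_t(x)$ the partial derivative with respect to $t$. Dots denote derivatives with respect to $t$. The quantity bounded is the continuous-time static regret. *)

theory Defs
  imports "HOL-Analysis.Analysis"
begin

(* The time domain is the closed half-line [T0, infinity). All time derivatives are taken within
   it, hence they are one-sided at T0 and do not depend on values at times before T0. *)

definition time_deriv :: "real \<Rightarrow> (real \<Rightarrow> real) \<Rightarrow> real \<Rightarrow> real" where
  "time_deriv T0 g t = vector_derivative g (at t within {T0..})"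

definition C1_on :: "'a::real_normed_vector set \<Rightarrow> ('a \<Rightarrow> 'b::real_normed_vector) \<Rightarrow> bool" where
  "C1_on S F \<longleftrightarrow>
     (\<exists>D :: 'a \<Rightarrow> 'a \<Rightarrow>\<^sub>L 'b. continuous_on S D \<and>
        (\<forall>p\<in>S. (F has_derivative blinfun_apply (D p)) (at p within S)))"

(* D n is the n-th derivative of g on S. *)
definition smooth_real_on :: "real set \<Rightarrow> (real \<Rightarrow> real) \<Rightarrow> bool" where
  "smooth_real_on S g \<longleftrightarrow>
     (\<exists>D :: nat \<Rightarrow> real \<Rightarrow> real. (\<forall>t\<in>S. D 0 t = g t) \<and>
        (\<forall>n. \<forall>t\<in>S. (D n has_real_derivative D (Suc n) t) (at t within S)))"

definition time_varying_cost :: "real \<Rightarrow> (real \<Rightarrow> real \<Rightarrow> real) \<Rightarrow> bool" where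
  "time_varying_cost T0 f \<longleftrightarrow>
     C1_on ({T0..} \<times> UNIV) (\<lambda>(t, x). f t x) \<and>
     (\<forall>t\<ge>T0. convex_on UNIV (f t)) \<and>
     (\<forall>x. smooth_real_on {T0..} (\<lambda>t. f t x))"

abbreviation minimizer :: "(real \<Rightarrow> real) \<Rightarrow> real \<Rightarrow> bool" where
  "minimizer g x \<equiv> is_arg_min g (\<lambda>_. True) x"

(* x'' + (exp \<alpha> - \<alpha>') x' + exp (2 \<alpha> + \<beta>) (f_t)'(x) = 0, where v = x' and a = x''. *)
definition solves_flow ::
  "real \<Rightarrow> (real \<Rightarrow> real) \<Rightarrow> (real \<Rightarrow> real) \<Rightarrow> (real \<Rightarrow> real \<Rightarrow> real) \<Rightarrow> (real \<Rightarrow> real) \<Rightarrow> bool" where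
  "solves_flow T0 \<alpha> \<beta> f x \<longleftrightarrow>
     (\<exists>v a. \<forall>t\<ge>T0.
        (x has_real_derivative v t) (at t within {T0..}) \<and>
        (v has_real_derivative a t) (at t within {T0..}) \<and>
        a t + (exp (\<alpha> t) - time_deriv T0 \<alpha> t) * v t
          + exp (2 * \<alpha> t + \<beta> t) * deriv (f t) (x t) = 0)"

end

theory Submission
  imports Defs
begin

text \<open>
  Put z = x + exp (-\<alpha>) x'. The equation of motion says exactly that
  z' = -exp (\<alpha> + \<beta>) (f t)' (x). For a fixed comparison point u, consider the energy
  E = (z - u)^2 / 2 + exp \<beta> (f t x - f t u). The terms with x' cancel in its derivative, and convexity
  together with exp (\<alpha> + \<beta>) - \<beta>' exp \<beta> = \<sigma> gives
  E' \<le> -\<sigma> (f t x - f t u) + 2 L exp \<beta>, where L bounds the time derivative of f. Integrating bounds the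
  regret against u by E(T0) - E(T) plus a multiple of the integral of (t + b0) powr m,
  which converges because m < -1. No bound on the trajectory is needed: -E(T) is controlled
  by comparing x(T) with a minimizer of f T.
\<close>

section \<open>Derivatives in time and space from the total derivative\<close>

lemma time_deriv_eq:
  assumes "(g has_real_derivative d) (at t within {T0..})" "t \<ge> T0"
  shows "time_deriv T0 g t = d"
proof -
  have "at t within {T0..} \<noteq> bot"
    using assms(2) at_le[of "{t<..}" "{T0..}" t] trivial_limit_at_right_real[of t]
    by (metis Ioi_le_Ico Ici_subset_Ioi_iff bot.extremum_uniqueI atLeast_subset_iff order_trans)
  then show ?thesis
    unfolding time_deriv_def using assms(1)
    by (intro vector_derivative_within) (simp_all add: has_real_derivative_iff_has_vector_derivative)
qed

text \<open>Both facts are read off one total derivative \<open>D\<close> at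
  \<open>(t, x t)\<close>: \<open>D (1, 0)\<close> is the time derivative and
  \<open>D (0, 1)\<close> the space derivative. This is where joint differentiability in time and
  space enters.\<close>

lemma
  assumes "time_varying_cost T0 f" "t \<ge> T0" "(x has_real_derivative v) (at t within {T0..})"
  shows cost_has_space_deriv: "(f t has_real_derivative deriv (f t) (x t)) (at (x t))"
    and cost_chain_rule: "((\<lambda>s. f s (x s)) has_real_derivative
           time_deriv T0 (\<lambda>s. f s (x t)) t + deriv (f t) (x t) * v) (at t within {T0..})"
proof -
  define F where "F = (\<lambda>(t, x). f t x)"
  from assms obtain D where D: "(F has_derivative D) (at (t, x t) within {T0..} \<times> UNIV)"
    unfolding time_varying_cost_def C1_on_def F_def by force
  then interpret D: bounded_linear D
    by (rule has_derivative_bounded_linear)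
  have along: "((\<lambda>s. F (s, y s)) has_derivative (\<lambda>h. D (h, w * h))) (at t within {T0..})"
    if "(y has_real_derivative w) (at t within {T0..})" "y t = x t" for y w
  proof -
    have "((\<lambda>s. (s, y s)) has_derivative (\<lambda>h. (h, w * h))) (at t within {T0..})"
      using that(1) unfolding has_field_derivative_def by (intro derivative_intros)
    moreover have "(F has_derivative D) (at (t, y t) within (\<lambda>s. (s, y s)) ` {T0..})"
      using D that(2) by (auto intro: has_derivative_subset)
    ultimately show ?thesis
      using diff_chain_within by (fastforce simp: o_def)
  qed
  have scale: "D (h, w * h) = h * (D (1, 0) + D (0, 1) * w)" for h w
  proof -
    have "(h, w * h) = h *\<^sub>R (1, 0) + (h * w) *\<^sub>R (0, 1)"
      by (simp add: scaleR_prod_def)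
    then show ?thesis
      by (simp only: D.add D.scaleR) (simp add: algebra_simps)
  qed
  \<comment> \<open>Kept general in \<open>y\<close>: a constant curve identifies
    \<open>D (1, 0)\<close> with \<open>time_deriv\<close>, while the curve \<open>x\<close> itself
    gives the chain rule.\<close>
  have along': "((\<lambda>s. f s (y s)) has_real_derivative D (1, 0) + D (0, 1) * w) (at t within {T0..})"
    if "(y has_real_derivative w) (at t within {T0..})" "y t = x t" for y w
    using along[OF that] unfolding F_def has_field_derivative_def scale
    by (simp add: mult.commute[of _ "_ + _"])
  have "time_deriv T0 (\<lambda>s. f s (x t)) t = D (1, 0)"
    using along'[of "\<lambda>_. x t" 0] assms(2) by (auto intro: time_deriv_eq)
  \<comment> \<open>The whole line of points with time \<open>t\<close> lies in the domain, so in
    space the derivative is two-sided even at \<open>t = T0\<close>.\<close>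
  moreover have space: "(f t has_real_derivative D (0, 1)) (at (x t))"
  proof -
    have "((\<lambda>y. (t, y)) has_derivative (\<lambda>h. (0, h))) (at (x t))"
      by (intro derivative_intros)
    moreover have "(F has_derivative D) (at (t, x t) within range (Pair t))"
      using D assms(2) by (auto intro: has_derivative_subset)
    ultimately have "((\<lambda>y. F (t, y)) has_derivative (\<lambda>h. D (0, h))) (at (x t))"
      using diff_chain_within[of "Pair t" "\<lambda>h. (0, h)" "x t" UNIV F D] by (simp add: o_def)
    moreover have "(\<lambda>h. D (0, h)) = (*) (D (0, 1))"
    proof
      fix h :: real
      have "(0 :: real, h) = h *\<^sub>R (0, 1)"
        by (simp add: scaleR_prod_def)
      then show "D (0, h) = D (0, 1) * h"
        by (simp only: D.scaleR) simp
    qed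
    ultimately show ?thesis
      by (simp add: F_def has_field_derivative_def)
  qed
  moreover note DERIV_imp_deriv[OF space]
  ultimately show
    "(f t has_real_derivative deriv (f t) (x t)) (at (x t))"
    "((\<lambda>s. f s (x s)) has_real_derivative
       time_deriv T0 (\<lambda>s. f s (x t)) t + deriv (f t) (x t) * v) (at t within {T0..})"
    using along'[OF assms(3)] by simp_all
qed

section \<open>The energy and the regret against a fixed point\<close>

lemma energy_deriv:
  fixes f :: "real \<Rightarrow> real \<Rightarrow> real" and \<alpha> \<beta> x v :: "real \<Rightarrow> real"
  assumes cost: "time_varying_cost T0 f" and t: "t \<ge> T0"
    and x: "(x has_real_derivative v t) (at t within {T0..})"
    and v: "(v has_real_derivative a) (at t within {T0..})"
    and \<alpha>: "(\<alpha> has_real_derivative \<alpha>') (at t within {T0..})"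
    and \<beta>: "(\<beta> has_real_derivative \<beta>') (at t within {T0..})"
    and ode: "a + (exp (\<alpha> t) - \<alpha>') * v t + exp (2 * \<alpha> t + \<beta> t) * deriv (f t) (x t) = 0"
  shows "((\<lambda>t. (x t + exp (- \<alpha> t) * v t - u)\<^sup>2 / 2 + exp (\<beta> t) * (f t (x t) - f t u))
    has_real_derivative
      \<beta>' * exp (\<beta> t) * (f t (x t) - f t u)
      - exp (\<alpha> t + \<beta> t) * (deriv (f t) (x t) * (x t - u))
      + exp (\<beta> t) * (time_deriv T0 (\<lambda>s. f s (x t)) t - time_deriv T0 (\<lambda>s. f s u) t))
    (at t within {T0..})"
proof -
  define z where "z = (\<lambda>t. x t + exp (- \<alpha> t) * v t)"
  define g where "g = deriv (f t) (x t)"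
  have exp: "exp (- \<alpha> t) * exp (\<alpha> t) = 1"
    by (simp flip: exp_add)
  have "exp (- \<alpha> t) * exp (2 * \<alpha> t + \<beta> t) = exp (\<alpha> t + \<beta> t)"
    by (simp flip: exp_add)
  \<comment> \<open>The equation of motion times \<open>exp (- \<alpha> t)\<close>; the left side is
    the derivative of \<open>z\<close> by the product rule.\<close>
  with ode exp have eq:
    "v t + (exp (- \<alpha> t) * a - exp (- \<alpha> t) * \<alpha>' * v t) = - exp (\<alpha> t + \<beta> t) * g"
    unfolding g_def by algebra
  have "(z has_real_derivative - exp (\<alpha> t + \<beta> t) * g) (at t within {T0..})"
    unfolding z_def eq[symmetric]
    by (auto intro!: derivative_eq_intros x v \<alpha> simp: algebra_simps)
  moreover have "((\<lambda>s. f s u) has_real_derivative time_deriv T0 (\<lambda>s. f s u) t) (at t within {T0..})"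
    using cost_chain_rule[OF cost t, of "\<lambda>_. u" 0] by simp
  ultimately have deriv: "((\<lambda>t. (z t - u)\<^sup>2 / 2 + exp (\<beta> t) * (f t (x t) - f t u))
    has_real_derivative
      (z t - u) * (- exp (\<alpha> t + \<beta> t) * g)
      + (exp (\<beta> t) * \<beta>' * (f t (x t) - f t u)
      + exp (\<beta> t) * (time_deriv T0 (\<lambda>s. f s (x t)) t + g * v t - time_deriv T0 (\<lambda>s. f s u) t)))
    (at t within {T0..})"
    unfolding g_def
    by (auto intro!: derivative_eq_intros \<beta> cost_chain_rule[OF cost t x] simp: field_simps)
  \<comment> \<open>The velocity part of \<open>z\<close> contributes
    \<open>exp (\<beta> t) * v t\<close>; multiplied by \<open>- g\<close>, it cancels the
    chain-rule term \<open>exp (\<beta> t) * g * v t\<close>.\<close>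
  have "(z t - u) * exp (\<alpha> t + \<beta> t) = (x t - u) * exp (\<alpha> t + \<beta> t) + exp (\<beta> t) * v t"
    using exp unfolding z_def exp_add by algebra
  then have eq': "(z t - u) * (- exp (\<alpha> t + \<beta> t) * g)
      + (exp (\<beta> t) * \<beta>' * (f t (x t) - f t u)
      + exp (\<beta> t) * (time_deriv T0 (\<lambda>s. f s (x t)) t + g * v t - time_deriv T0 (\<lambda>s. f s u) t))
    = \<beta>' * exp (\<beta> t) * (f t (x t) - f t u)
      - exp (\<alpha> t + \<beta> t) * (g * (x t - u))
      + exp (\<beta> t) * (time_deriv T0 (\<lambda>s. f s (x t)) t - time_deriv T0 (\<lambda>s. f s u) t)"
    by algebra
  show ?thesis
    using deriv unfolding eq' unfolding z_def g_def .
qed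

text \<open>The derivative of \<open>E u\<close> is at most an explicit continuous function, so
  integrating the inequality suffices. Since \<open>u\<close> is arbitrary but constant in time, it
  may later be chosen depending on the horizon \<open>T\<close>.\<close>

lemma regret_bound:
  fixes f :: "real \<Rightarrow> real \<Rightarrow> real" and \<alpha> \<beta> \<alpha>' \<beta>' x :: "real \<Rightarrow> real"
  assumes cost: "time_varying_cost T0 f" and T: "T0 \<le> T"
    and x: "\<And>t. t \<ge> T0 \<Longrightarrow> (x has_real_derivative v t) (at t within {T0..})"
    and v: "\<And>t. t \<ge> T0 \<Longrightarrow> (v has_real_derivative a t) (at t within {T0..})"
    and \<alpha>: "\<And>t. t \<ge> T0 \<Longrightarrow> (\<alpha> has_real_derivative \<alpha>' t) (at t within {T0..})"
    and \<beta>: "\<And>t. t \<ge> T0 \<Longrightarrow> (\<beta> has_real_derivative \<beta>' t) (at t within {T0..})"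
    and ode: "\<And>t. t \<ge> T0 \<Longrightarrow>
      a t + (exp (\<alpha> t) - \<alpha>' t) * v t + exp (2 * \<alpha> t + \<beta> t) * deriv (f t) (x t) = 0"
    and \<sigma>: "\<And>t. t \<ge> T0 \<Longrightarrow> exp (\<alpha> t + \<beta> t) - \<beta>' t * exp (\<beta> t) = \<sigma>"
    and L: "\<And>t y. t \<ge> T0 \<Longrightarrow> \<bar>time_deriv T0 (\<lambda>s. f s y) t\<bar> \<le> L"
  defines "E \<equiv> \<lambda>u t. (x t + exp (- \<alpha> t) * v t - u)\<^sup>2 / 2 + exp (\<beta> t) * (f t (x t) - f t u)"
  shows "\<sigma> * integral {T0..T} (\<lambda>t. f t (x t) - f t u)
    \<le> E u T0 - E u T + 2 * L * integral {T0..T} (\<lambda>t. exp (\<beta> t))"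
proof -
  define E' where "E' = (\<lambda>t. \<beta>' t * exp (\<beta> t) * (f t (x t) - f t u)
      - exp (\<alpha> t + \<beta> t) * (deriv (f t) (x t) * (x t - u))
      + exp (\<beta> t) * (time_deriv T0 (\<lambda>s. f s (x t)) t - time_deriv T0 (\<lambda>s. f s u) t))"
  have deriv_E: "(E u has_real_derivative E' t) (at t within {T0..})" if "t \<ge> T0" for t
    unfolding E_def E'_def by (rule energy_deriv[OF cost that x v \<alpha> \<beta> ode]) (rule that)+
  \<comment> \<open>For the gauge integral this needs no continuity of \<open>E'\<close>; only the
    majorant below has to be shown integrable.\<close>
  have "(E' has_integral E u T - E u T0) {T0..T}"
    using T
    by (intro fundamental_theorem_of_calculus)
      (auto simp flip: has_real_derivative_iff_has_vector_derivative intro: DERIV_subset[OF deriv_E])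
  moreover have "((\<lambda>t. 2 * L * exp (\<beta> t) - \<sigma> * (f t (x t) - f t u)) has_integral
      2 * L * integral {T0..T} (\<lambda>t. exp (\<beta> t)) - \<sigma> * integral {T0..T} (\<lambda>t. f t (x t) - f t u)) {T0..T}"
  proof -
    have "continuous_on {T0..} \<beta>"
      using \<beta> by (auto intro: DERIV_continuous simp: continuous_on_eq_continuous_within)
    then have "continuous_on {T0..T} (\<lambda>t. exp (\<beta> t))"
      by (intro continuous_intros) (auto intro: continuous_on_subset)
    moreover have "continuous_on {T0..} (\<lambda>t. f t (y t))"
      if "\<And>t. t \<ge> T0 \<Longrightarrow> (y has_real_derivative w t) (at t within {T0..})" for y w
      using cost_chain_rule[OF cost _ that]
      by (auto intro: DERIV_continuous simp: continuous_on_eq_continuous_within)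
    from this[OF x] this[of "\<lambda>_. u" "\<lambda>_. 0"] have "continuous_on {T0..T} (\<lambda>t. f t (x t) - f t u)"
      by (intro continuous_intros) (auto intro: continuous_on_subset)
    ultimately show ?thesis
      by (intro has_integral_diff has_integral_mult_right integrable_integral
          integrable_continuous_interval)
  qed
  moreover have "E' t \<le> 2 * L * exp (\<beta> t) - \<sigma> * (f t (x t) - f t u)" if t: "t \<ge> T0" for t
  proof -
    have "convex_on UNIV (f t)"
      using cost t unfolding time_varying_cost_def by blast
    then have "deriv (f t) (x t) * (u - x t) \<le> f t u - f t (x t)"
      using cost_has_space_deriv[OF cost t x[OF t]]
      by (intro convex_on_imp_above_tangent[where A = UNIV]) auto
    then have "f t (x t) - f t u \<le> deriv (f t) (x t) * (x t - u)"
      by (simp add: algebra_simps)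
    \<comment> \<open>The cost difference may have either sign. Only the positive weight
      \<open>exp (\<alpha> t + \<beta> t)\<close> meets the tangent inequality; the
      \<open>\<beta>'\<close> term stays exact and combines with it to
      \<open>\<sigma>\<close>.\<close>
    then have "exp (\<alpha> t + \<beta> t) * (f t (x t) - f t u)
        \<le> exp (\<alpha> t + \<beta> t) * (deriv (f t) (x t) * (x t - u))"
      by (rule mult_left_mono) simp
    moreover have
      "exp (\<beta> t) * (time_deriv T0 (\<lambda>s. f s (x t)) t - time_deriv T0 (\<lambda>s. f s u) t) \<le> exp (\<beta> t) * (2 * L)"
      using L[OF t, of "x t"] L[OF t, of u] by (intro mult_left_mono) auto
    ultimately show ?thesis
      unfolding E'_def \<sigma>[OF t, symmetric] by (simp add: algebra_simps)
  qed
  ultimately have "E u T - E u T0 \<le>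
      2 * L * integral {T0..T} (\<lambda>t. exp (\<beta> t)) - \<sigma> * integral {T0..T} (\<lambda>t. f t (x t) - f t u)"
    by (rule has_integral_le) auto
  then show ?thesis
    by simp
qed

section \<open>Convergence of the weight and the uniform constant\<close>

lemma integral_powr_le:
  fixes T0 T b m :: real
  assumes "T0 \<le> T" "T0 + b > 0" "m < -1"
  shows "integral {T0..T} (\<lambda>t. (t + b) powr m) \<le> (T0 + b) powr (m + 1) / (- m - 1)"
proof -
  have "((\<lambda>t. (t + b) powr m) has_integral
      (T + b) powr (m + 1) / (m + 1) - (T0 + b) powr (m + 1) / (m + 1)) {T0..T}"
    using assms
    by (intro fundamental_theorem_of_calculus)
      (auto simp flip: has_real_derivative_iff_has_vector_derivative intro!: derivative_eq_intros)
  moreover have "(T + b) powr (m + 1) / (m + 1) \<le> 0"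
    using assms by (simp add: divide_nonneg_neg)
  moreover have "- ((T0 + b) powr (m + 1) / (m + 1)) = (T0 + b) powr (m + 1) / (- m - 1)"
    using assms by (simp add: field_simps)
  ultimately show ?thesis
    by (simp add: integral_unique)
qed

theorem theorem1:
  fixes T0 \<sigma> m b0 :: real
    and f :: "real \<Rightarrow> real \<Rightarrow> real"
    and xstar xtilde \<alpha> \<beta> x :: "real \<Rightarrow> real"
  assumes T0: "T0 \<ge> 0"
    and cost: "time_varying_cost T0 f"
    and A1_min: "\<And>t. t \<ge> T0 \<Longrightarrow> minimizer (f t) (xstar t)"
    and A1_bdd: "\<exists>c0>0. \<forall>t\<ge>T0. \<bar>xstar t\<bar> \<le> c0"
    and A2_min: "\<And>T. T > T0 \<Longrightarrow> minimizer (\<lambda>y. integral {T0..T} (\<lambda>t. f t y)) (xtilde T)"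
    and A2_bdd: "\<exists>K. \<forall>T>T0. \<bar>xtilde T\<bar> \<le> K"
    and A3: "\<forall>R>0. \<exists>M>0. \<forall>t\<ge>T0. \<forall>y. \<bar>y\<bar> \<le> R \<longrightarrow> \<bar>f t y\<bar> \<le> M"
    and A4: "\<exists>L. \<forall>t\<ge>T0. \<forall>y. \<bar>time_deriv T0 (\<lambda>s. f s y) t\<bar> \<le> L"
    and \<sigma>: "\<sigma> > 0"
    and m: "m < -1"
    and b0: "b0 > 0" "b0 > (- m / \<sigma>) powr (1 / (1 - m))"
    and \<beta>: "\<And>t. t \<ge> T0 \<Longrightarrow> exp (\<beta> t) = (t + b0) powr m"
    and \<alpha>: "\<And>t. t \<ge> T0 \<Longrightarrow>
              exp (\<alpha> t) = m * (t + b0) powr (-1) + \<sigma> * (t + b0) powr (- m)"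
    and sol: "solves_flow T0 \<alpha> \<beta> f x"
  shows "\<exists>c>0. \<forall>T>T0.
           integral {T0..T} (\<lambda>t. f t (x t) - f t (xtilde T)) \<le> c / \<sigma>"
proof -
  obtain c0 where c0: "c0 > 0" "\<And>t. t \<ge> T0 \<Longrightarrow> \<bar>xstar t\<bar> \<le> c0"
    using A1_bdd by blast
  obtain K where K: "\<And>T. T > T0 \<Longrightarrow> \<bar>xtilde T\<bar> \<le> K"
    using A2_bdd by blast
  obtain L where L: "\<And>t y. t \<ge> T0 \<Longrightarrow> \<bar>time_deriv T0 (\<lambda>s. f s y) t\<bar> \<le> L"
    using A4 by blast
  obtain v a where
    x: "\<And>t. t \<ge> T0 \<Longrightarrow> (x has_real_derivative v t) (at t within {T0..})" and
    v: "\<And>t. t \<ge> T0 \<Longrightarrow> (v has_real_derivative a t) (at t within {T0..})" and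
    ode: "\<And>t. t \<ge> T0 \<Longrightarrow> a t + (exp (\<alpha> t) - time_deriv T0 \<alpha> t) * v t
      + exp (2 * \<alpha> t + \<beta> t) * deriv (f t) (x t) = 0"
    using sol unfolding solves_flow_def by blast
  have pos: "t + b0 > 0" if "t \<ge> T0" for t
    using that T0 b0 by linarith
  have deriv_\<beta>: "(\<beta> has_real_derivative m / (t + b0)) (at t within {T0..})" if t: "t \<ge> T0" for t
  proof -
    have "((\<lambda>t. m * ln (t + b0)) has_real_derivative m / (t + b0)) (at t within {T0..})"
      using pos[OF t] by (auto intro!: derivative_eq_intros)
    \<comment> \<open>\<open>\<beta>\<close> is prescribed only on \<open>{T0..}\<close>, so the
      derivative is transferred within that set.\<close>
    moreover have "\<beta> s = m * ln (s + b0)" if "s \<ge> T0" for s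
      using \<beta>[OF that] pos[OF that] by (metis ln_exp ln_powr)
    ultimately show ?thesis
      using t by - (rule has_field_derivative_transform_within[where d = 1], auto)
  qed
  have deriv_\<alpha>: "(\<alpha> has_real_derivative time_deriv T0 \<alpha> t) (at t within {T0..})" if t: "t \<ge> T0" for t
  proof -
    define h where "h = (\<lambda>t. m * (t + b0) powr (-1) + \<sigma> * (t + b0) powr (- m))"
    have \<alpha>_eq: "\<alpha> s = ln (h s)" if "s \<ge> T0" for s
      using \<alpha>[OF that] unfolding h_def by (metis ln_exp)
    have "h t > 0"
      using \<alpha>[OF t] unfolding h_def by (metis exp_gt_zero)
    have powr: "((\<lambda>t. (t + b0) powr p) has_real_derivative p * (t + b0) powr (p - 1)) (at t within {T0..})" for p
      using pos[OF t] by (auto intro!: derivative_eq_intros)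
    \<comment> \<open>Existence is enough here: the equation of motion refers to
      \<open>time_deriv T0 \<alpha>\<close>, so no formula for the derivative of
      \<open>\<alpha>\<close> is required.\<close>
    obtain h' where "(h has_real_derivative h') (at t within {T0..})"
      unfolding h_def using DERIV_add[OF DERIV_cmult[OF powr] DERIV_cmult[OF powr]] by blast
    then have "((\<lambda>t. ln (h t)) has_real_derivative 1 / h t * h') (at t within {T0..})"
      by (rule DERIV_chain2[where f = ln and g = h, OF DERIV_ln_divide[OF \<open>h t > 0\<close>]])
    then have "(\<alpha> has_real_derivative 1 / h t * h') (at t within {T0..})"
      using t \<alpha>_eq by - (rule has_field_derivative_transform_within[where d = 1], auto)
    then show ?thesis
      using time_deriv_eq[OF _ t] by metis
  qed
  have scale: "exp (\<alpha> t + \<beta> t) - m / (t + b0) * exp (\<beta> t) = \<sigma>" if t: "t \<ge> T0" for t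
  proof -
    have "(t + b0) powr (- m) * (t + b0) powr m = 1" "(t + b0) powr (-1) = 1 / (t + b0)"
      using pos[OF t] by (simp_all add: powr_minus_divide)
    then show ?thesis
      unfolding exp_add \<alpha>[OF t] \<beta>[OF t] by (simp add: algebra_simps)
  qed

  define z0 where "z0 = x T0 + exp (- \<alpha> T0) * v T0"
  \<comment> \<open>This radius covers \<open>x T0\<close>, every \<open>xtilde T\<close> and every
    \<open>xstar t\<close> at once; later positions of the trajectory are not covered.\<close>
  obtain M where M: "M > 0" "\<And>t y. t \<ge> T0 \<Longrightarrow> \<bar>y\<bar> \<le> \<bar>x T0\<bar> + \<bar>K\<bar> + c0 \<Longrightarrow> \<bar>f t y\<bar> \<le> M"
  proof -
    have "\<bar>x T0\<bar> + \<bar>K\<bar> + c0 > 0"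
      using c0(1) by linarith
    then show ?thesis
      using A3 that by blast
  qed
  define B where "B = (T0 + b0) powr m"
  define C where "C = (T0 + b0) powr (m + 1) / (- m - 1)"
  \<comment> \<open>In order: the initial square, the two potential terms at times \<open>T0\<close>
    and \<open>T\<close>, the drift of the cost in time, and 1 for strict positivity. None of these
    depends on \<open>T\<close>.\<close>
  define c where "c = z0\<^sup>2 + K\<^sup>2 + 2 * (B * (2 * M)) + 2 * (L * C) + 1"
  have "L \<ge> 0"
    using L[of T0 0] by linarith
  have "B \<ge> 0" "C \<ge> 0"
    using m unfolding B_def C_def by simp_all
  have "c > 0"
    unfolding c_def using M(1) \<open>L \<ge> 0\<close> \<open>B \<ge> 0\<close> \<open>C \<ge> 0\<close> by (intro add_nonneg_pos add_nonneg_nonneg) simp_all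
  moreover have "integral {T0..T} (\<lambda>t. f t (x t) - f t (xtilde T)) \<le> c / \<sigma>" if T: "T > T0" for T
  proof -
    define u where "u = xtilde T"
    have u: "\<bar>u\<bar> \<le> \<bar>K\<bar>"
      using K[OF T] unfolding u_def by linarith
    have "(z0 - u)\<^sup>2 / 2 \<le> z0\<^sup>2 + u\<^sup>2"
      using zero_le_power2[of "z0 + u"] by (simp add: power2_eq_square algebra_simps)
    also have "\<dots> \<le> z0\<^sup>2 + K\<^sup>2"
      using u by (simp add: abs_le_square_iff)
    finally have "(z0 - u)\<^sup>2 / 2 \<le> z0\<^sup>2 + K\<^sup>2" .
    moreover have "exp (\<beta> T0) * (f T0 (x T0) - f T0 u) \<le> B * (2 * M)"
    proof -
      have "\<bar>f T0 (x T0)\<bar> \<le> M" "\<bar>f T0 u\<bar> \<le> M"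
        using c0(1) u by (auto intro!: M(2))
      then show ?thesis
        unfolding \<beta>[OF order_refl] B_def by (intro mult_left_mono) auto
    qed
    \<comment> \<open>The position \<open>x T\<close> may be far away, but \<open>f T (x T)\<close>
      is at least the minimum value \<open>f T (xstar T)\<close>, hence at least
      \<open>- M\<close>.\<close>
    moreover have "exp (\<beta> T) * (f T u - f T (x T)) \<le> B * (2 * M)"
    proof -
      have "f T (xstar T) \<le> f T (x T)"
        using A1_min[of T] T by (simp add: is_arg_min_linorder)
      moreover have "\<bar>f T (xstar T)\<bar> \<le> M" "\<bar>f T u\<bar> \<le> M"
        using T c0(1) c0(2)[of T] u by (auto intro!: M(2))
      ultimately have "exp (\<beta> T) * (f T u - f T (x T)) \<le> exp (\<beta> T) * (2 * M)"
        by (intro mult_left_mono) auto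
      \<comment> \<open>The exponent \<open>m\<close> is negative, so the weight is largest at
        \<open>T0\<close>.\<close>
      moreover have "exp (\<beta> T) \<le> B"
        using \<beta>[of T] T pos[of T0] m unfolding B_def by (simp add: powr_mono2')
      then have "exp (\<beta> T) * (2 * M) \<le> B * (2 * M)"
        using M(1) by (intro mult_right_mono) auto
      ultimately show ?thesis
        by linarith
    qed
    moreover have "L * integral {T0..T} (\<lambda>t. exp (\<beta> t)) \<le> L * C"
    proof (rule mult_left_mono)
      have "integral {T0..T} (\<lambda>t. exp (\<beta> t)) = integral {T0..T} (\<lambda>t. (t + b0) powr m)"
        using \<beta> by (intro integral_cong) simp
      also have "\<dots> \<le> C"
        unfolding C_def using T pos[of T0] m by (intro integral_powr_le) auto
      finally show "integral {T0..T} (\<lambda>t. exp (\<beta> t)) \<le> C" .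
    qed fact
    moreover have "\<sigma> * integral {T0..T} (\<lambda>t. f t (x t) - f t u)
      \<le> (z0 - u)\<^sup>2 / 2 + exp (\<beta> T0) * (f T0 (x T0) - f T0 u)
        - ((x T + exp (- \<alpha> T) * v T - u)\<^sup>2 / 2 + exp (\<beta> T) * (f T (x T) - f T u))
        + 2 * L * integral {T0..T} (\<lambda>t. exp (\<beta> t))"
      unfolding z0_def
      by (rule regret_bound[OF cost less_imp_le[OF T] x v deriv_\<alpha> deriv_\<beta> ode scale L])
    \<comment> \<open>The terminal square enters with a minus sign and is discarded, so no bound on
      the velocity at \<open>T\<close> is involved.\<close>
    moreover have "(x T + exp (- \<alpha> T) * v T - u)\<^sup>2 \<ge> 0"
      by simp
    ultimately have "\<sigma> * integral {T0..T} (\<lambda>t. f t (x t) - f t u) \<le> c"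
      unfolding c_def right_diff_distrib by linarith
    then show ?thesis
      using \<sigma> by (simp add: u_def pos_le_divide_eq mult.commute)
  qed
  ultimately show ?thesis
    by blast
qed

end
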